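(* Let $m=m_n\ge 1$ and $d=d_n$ be integers with $2\le d\le n$ and $m \ll \binom{n}{d}^{1/2}$. Let $H_{nmd}$ be a hypergraph sampled uniformly at random from the set of hypergraphs on node set $\{1,\dots,n\}$ having exactly $m$ distinct hyperedges, each of size $d$. Then, as $n\to\infty$, \[ \mathbb{P}(H_{nmd} \text{ is connected}) \to \begin{cases} 0 & \text{if } \log n + m\log(1-d/n) \to +\infty,\\ 1 & \text{if } \log n + m\log(1-d/n) \to -\infty.\end{cases} \]
   Context: A hypergraph on node set $V$ is a collection of nonempty subsets (hyperedges) of $V$; it is connected if for every partition of $V$ into nonempty sets $V_1,V_2$ some hyperedge meets both $V_1$ and $V_2$. $a_n\ll b_n$ means $a_n/|b_n|\to0$. The convention $\log 0 = -\infty$ is used. *)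

theory Defs
  imports "HOL-Probability.Probability"
begin

definition hg_connected :: "'a set \<Rightarrow> 'a set set \<Rightarrow> bool" where
  "hg_connected V E \<longleftrightarrow>
     (\<forall>V1 V2. V1 \<noteq> {} \<and> V2 \<noteq> {} \<and> V1 \<union> V2 = V \<and> V1 \<inter> V2 = {} \<longrightarrow>
        (\<exists>e\<in>E. e \<inter> V1 \<noteq> {} \<and> e \<inter> V2 \<noteq> {}))"

definition hypergraphs :: "nat \<Rightarrow> nat \<Rightarrow> nat \<Rightarrow> nat set set set" where
  "hypergraphs n m d = {E. E \<subseteq> {e. e \<subseteq> {1..n} \<and> card e = d} \<and> card E = m}"

definition prob_connected :: "nat \<Rightarrow> nat \<Rightarrow> nat \<Rightarrow> real" where
  "prob_connected n m d =
     measure_pmf.prob (pmf_of_set (hypergraphs n m d)) {E. hg_connected {1..n} E}"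

text \<open>log n + m log(1 - d/n), with the convention log 0 = -\<infinity>.\<close>
definition thr :: "nat \<Rightarrow> nat \<Rightarrow> nat \<Rightarrow> ereal" where
  "thr n m d = (if 1 - real d / real n \<le> 0 then -\<infinity>
                else ereal (ln (real n) + real m * ln (1 - real d / real n)))"

end

theory Submission
  imports Defs
begin

text \<open>
  Write \<open>N = n choose d\<close>, \<open>q = 1 - d/n\<close>, so that the threshold quantity is \<open>ln (n q\<^sup>m)\<close>.

  If \<open>n q\<^sup>m \<rightarrow> \<infinity>\<close>, the second moment method produces isolated nodes. The events that two given
  nodes are isolated are negatively correlated, because \<open>b \<mapsto> b choose d\<close> is log-concave and convex;
  hence the probability of having no isolated node is at most the inverse of their expected number.
  That expectation is at least \<open>n q\<^sup>m (1 - m\<^sup>2/(q N))\<close>. The hypothesis on \<open>m\<close> makes \<open>m\<^sup>2/(q N)\<close>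
  vanish when \<open>q \<ge> 1/2\<close>; otherwise \<open>n q\<^sup>m \<ge> 1\<close> forces \<open>2\<^sup>m \<le> n\<close>, while \<open>N\<close> is at least of order \<open>n\<^sup>2\<close>.

  If \<open>n q\<^sup>m \<rightarrow> 0\<close>, take a union bound over node sets of size \<open>k \<le> n/2\<close> not cut by any hyperedge. A
  random \<open>d\<close>-set fails to cut such a set with probability at most \<open>q powr (k (n - k)/n)\<close>, and
  summing over sets leaves a geometric series with ratio \<open>e\<^sup>2 sqrt (n q\<^sup>m)\<close>.
\<close>

subsection \<open>Binomial coefficients\<close>

lemma Suc_times_binomial_Suc_real:
  assumes "k \<le> n"
  shows "real (Suc k) * real (n choose Suc k) = (real n - real k) * real (n choose k)"
proof -
  have "Suc k * (n choose Suc k) = (n - k) * (n choose k)"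
    using binomial_absorption[of k n] binomial_absorb_comp[of n k] by simp
  then have "real (Suc k) * real (n choose Suc k) = real (n - k) * real (n choose k)"
    by (metis of_nat_mult)
  then show ?thesis using assms by (simp add: of_nat_diff)
qed

lemma binomial_Suc_real:
  assumes "k \<le> n"
  shows "real (n choose Suc k) = real (n choose k) * (real n - real k) / real (Suc k)"
  using Suc_times_binomial_Suc_real[OF assms] by (simp add: field_simps del: of_nat_Suc)

lemma binomial_mono_upper: "n \<le> n' \<Longrightarrow> n choose k \<le> n' choose k"
proof (induction n' rule: dec_induct)
  case (step n')
  have "n' choose k \<le> Suc n' choose k" by (cases k) auto
  with step show ?case by simp
qed simp

text \<open>This is where \<open>q = 1 - d/n\<close> enters: it is the probability that a random
  \<open>d\<close>-set avoids a fixed node.\<close>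

lemma binomial_pred_upper_real:
  assumes "d \<le> n" "0 < n"
  shows "real ((n - 1) choose d) = (1 - real d / real n) * real (n choose d)"
proof -
  have "real (n - d) * real (n choose d) = real n * real ((n - 1) choose d)"
    by (metis binomial_absorb_comp of_nat_mult)
  then show ?thesis using assms by (simp add: of_nat_diff field_simps)
qed

text \<open>Each new factor \<open>(a - m)/(b - m)\<close> is at most \<open>a/b\<close>: drawing
  without replacement lands in a subset of size \<open>a\<close> no more often than independent
  draws do.\<close>

lemma binomial_ratio_le_power:
  assumes "a \<le> b"
  shows "real (a choose m) * real b ^ m \<le> real (b choose m) * real a ^ m"
proof (induction m)
  case (Suc m)
  show ?case
  proof (cases "Suc m \<le> a")
    case True
    have "(real a - real m) * real b \<le> (real b - real m) * real a"
      using assms mult_left_mono[of "real a" "real b" "real m"] by (simp add: algebra_simps)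
    then have "(real (a choose m) * real b ^ m) * ((real a - real m) * real b)
        \<le> (real (b choose m) * real a ^ m) * ((real b - real m) * real a)"
      using Suc True by (rule_tac mult_mono) auto
    then show ?thesis
      using True assms
      by (simp add: binomial_Suc_real divide_right_mono mult_ac del: of_nat_Suc)
  qed (simp add: binomial_eq_0)
qed simp

text \<open>Factor by factor, \<open>(c - m) * (b - m)\<close> is at most the square of
  \<open>a - m\<close>: after expansion this is the first hypothesis plus \<open>m\<close> times the
  second. With \<open>c\<close>, \<open>a\<close>, \<open>b\<close> counting the
  \<open>d\<close>-sets that avoid two, one or no given nodes, the conclusion is the negative
  correlation of isolated nodes.\<close>

lemma binomial_upper_log_concave:
  assumes "c * b \<le> a\<^sup>2" "2 * a \<le> c + b" "c \<le> a" "a \<le> b"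
  shows "real (c choose m) * real (b choose m) \<le> (real (a choose m))\<^sup>2"
proof (induction m)
  case (Suc m)
  show ?case
  proof (cases "Suc m \<le> c")
    case True
    have 1: "real c * real b \<le> (real a)\<^sup>2"
      using assms(1) by (metis of_nat_le_iff of_nat_mult of_nat_power)
    have 2: "real m * (2 * real a) \<le> real m * (real c + real b)"
      using assms(2) by (intro mult_left_mono) auto
    have "(real c - real m) * (real b - real m) \<le> (real a - real m)\<^sup>2"
      using 1 2 by (simp add: algebra_simps power2_eq_square)
    then have "(real (c choose m) * real (b choose m)) * ((real c - real m) * (real b - real m))
        \<le> (real (a choose m))\<^sup>2 * (real a - real m)\<^sup>2"
      using Suc True assms by (intro mult_mono) auto
    then have "(real (c choose m) * real (b choose m)) * ((real c - real m) * (real b - real m))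
          / (real (Suc m))\<^sup>2
        \<le> (real (a choose m))\<^sup>2 * (real a - real m)\<^sup>2 / (real (Suc m))\<^sup>2"
      by (intro divide_right_mono) auto
    then show ?thesis
      using True assms
      by (simp add: binomial_Suc_real power_divide power_mult_distrib power2_eq_square
          mult_ac del: of_nat_Suc)
  qed (simp add: binomial_eq_0)
qed simp

text \<open>The successive ratios are \<open>1 - d/n\<close> and \<open>1 - d/(n - 1)\<close>, and
  the latter is no larger.\<close>

lemma binomial_pred_pred_log_concave:
  assumes "d \<le> n - 1" "2 \<le> n"
  shows "((n - 2) choose d) * (n choose d) \<le> ((n - 1) choose d)\<^sup>2"
proof -
  let ?x = "real (n choose d)" and ?y = "real ((n - 1) choose d)"
  have y: "?y = (1 - real d / real n) * ?x"
    using assms by (intro binomial_pred_upper_real) auto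
  have "real ((n - 1 - 1) choose d) = (1 - real d / real (n - 1)) * ?y"
    using assms by (intro binomial_pred_upper_real) auto
  then have z: "real ((n - 2) choose d) = (1 - real d / real (n - 1)) * ?y"
    by (simp add: numeral_2_eq_2)
  have "1 - real d / real (n - 1) \<le> 1 - real d / real n"
    using assms by (simp add: divide_left_mono)
  then have "(1 - real d / real (n - 1)) * (?x * ?y) \<le> (1 - real d / real n) * (?x * ?y)"
    by (intro mult_right_mono) auto
  then have "real ((n - 2) choose d) * ?x \<le> ?y * ?y"
    unfolding z by (subst (3) y) (simp add: mult_ac)
  then show ?thesis
    by (metis of_nat_le_iff of_nat_mult power2_eq_square)
qed

text \<open>By Pascal's rule the successive differences are binomials with lower index
  \<open>d - 1\<close>, which grow with the upper index.\<close>

lemma binomial_pred_pred_convex: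
  assumes "1 \<le> d" "2 \<le> n"
  shows "2 * ((n - 1) choose d) \<le> ((n - 2) choose d) + (n choose d)"
proof -
  obtain k where k: "n = Suc (Suc k)" using assms(2) by (metis add_2_eq_Suc le_Suc_ex)
  obtain e where e: "d = Suc e" using assms(1) by (cases d) auto
  have "k choose e \<le> Suc k choose e" by (rule binomial_mono_upper) simp
  then show ?thesis unfolding k e by simp
qed

text \<open>A near converse of \<open>binomial_ratio_le_power\<close>: each factor
  \<open>(a - k)/(b - k)\<close> is at least \<open>q * (1 - k/a)\<close>, and the Weierstrass
  product inequality collects the corrections into \<open>1 - m^2/a\<close>.\<close>

lemma binomial_ratio_ge_power:
  assumes "real a = q * real b" "0 \<le> q" "a \<le> b" "0 < a" "m \<le> a"
  shows "real (b choose m) * q ^ m * (1 - (real m)\<^sup>2 / real a) \<le> real (a choose m)"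
proof -
  have "q \<noteq> 0" using assms by auto
  have prod: "real (b choose k) * q ^ k * (\<Prod>i<k. 1 - real i / real a) \<le> real (a choose k)"
    if "k \<le> a" for k
    using that
  proof (induction k)
    case (Suc k)
    have nn: "0 \<le> (\<Prod>i<k. 1 - real i / real a)"
      using Suc.prems by (intro prod_nonneg) auto
    have "(real b - real k) * q * (1 - real k / real a) \<le> real b * q * (1 - real k / real a)"
      using Suc.prems assms by (intro mult_right_mono) auto
    also have "\<dots> = real a - real k"
      using assms \<open>q \<noteq> 0\<close> by (simp add: field_simps)
    finally have "(real (b choose k) * q ^ k * (\<Prod>i<k. 1 - real i / real a))
        * ((real b - real k) * q * (1 - real k / real a))
        \<le> real (a choose k) * (real a - real k)"
      using Suc assms nn by (intro mult_mono) auto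
    then show ?case
      using Suc.prems assms(3)
      by (simp add: binomial_Suc_real divide_right_mono mult_ac del: of_nat_Suc)
  qed simp
  have "(\<Sum>i<m. real i / real a) \<le> (\<Sum>i<m. real m / real a)"
    by (intro sum_mono divide_right_mono) auto
  also have "\<dots> = (real m)\<^sup>2 / real a" by (simp add: power2_eq_square)
  finally have "1 - (real m)\<^sup>2 / real a \<le> 1 - (\<Sum>i<m. real i / real a)" by simp
  also have "\<dots> \<le> (\<Prod>i<m. 1 - real i / real a)"
    using assms by (intro Weierstrass_prod_ineq) auto
  finally have "real (b choose m) * q ^ m * (1 - (real m)\<^sup>2 / real a)
      \<le> real (b choose m) * q ^ m * (\<Prod>i<m. 1 - real i / real a)"
    using assms by (intro mult_left_mono) auto
  also have "\<dots> \<le> real (a choose m)" using assms by (intro prod)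
  finally show ?thesis .
qed

subsection \<open>Uncut sets\<close>

text \<open>Weighted AM-GM for \<open>(1 - x) powr c\<close> and \<open>1\<close>, with weights
  \<open>1/c\<close> and \<open>1 - 1/c\<close>. The exponent is real because it will be
  \<open>k (n - k)/n\<close>.\<close>

lemma Bernoulli_powr:
  fixes x c :: real
  assumes "1 \<le> c" "x < 1"
  shows "1 - x * c \<le> (1 - x) powr c"
proof -
  have "((1 - x) powr c) powr (1 / c) * 1 powr (1 - 1 / c)
      \<le> 1 / c * (1 - x) powr c + (1 - 1 / c) * 1"
    using assms by (intro Youngs_inequality_0) auto
  then have "c * (1 - x) \<le> c * (1 / c * (1 - x) powr c + (1 - 1 / c))"
    using assms by (intro mult_left_mono) (auto simp: powr_powr)
  also have "\<dots> = (1 - x) powr c + c - 1"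
    using assms by (simp add: field_simps)
  finally show ?thesis by (simp add: algebra_simps)
qed

text \<open>Keep a single term of the exponential series. At \<open>x = k\<close> this serves as
  Stirling's lower bound for \<open>k!\<close>.\<close>

lemma power_le_exp_times_fact:
  fixes x :: real
  assumes "0 \<le> x"
  shows "x ^ k \<le> exp x * fact k"
proof -
  have "(\<Sum>n\<in>{k}. x ^ n /\<^sub>R fact n) \<le> exp x"
    unfolding exp_def using assms
    by (intro sum_le_suminf summable_exp_generic) auto
  then show ?thesis by (simp add: field_simps)
qed

text \<open>Raising \<open>d\<close> by one multiplies the two binomials by
  \<open>(k - d)/(d + 1)\<close> and \<open>(n - k - d)/(d + 1)\<close>; as \<open>k\<close> is the
  smaller part, the second factor dominates. Truncated subtraction covers \<open>d > n - k\<close>,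
  where both sides vanish.\<close>

lemma binomial_sum_Suc_le:
  assumes "2 * k \<le> n" "d < n"
  shows "real (Suc d) * (real (k choose Suc d) + real ((n - k) choose Suc d))
    \<le> real (n - k - d) * (real (k choose d) + real ((n - k) choose d))"
proof (cases "d \<le> n - k")
  case True
  have "real (Suc d) * real (k choose Suc d) \<le> real (n - k - d) * real (k choose d)"
  proof (cases "d \<le> k")
    case True
    have "(real k - real d) * real (k choose d) \<le> real (n - k - d) * real (k choose d)"
      using assms True by (intro mult_right_mono) auto
    with Suc_times_binomial_Suc_real[OF True] show ?thesis by simp
  qed (simp add: binomial_eq_0)
  moreover have "real (Suc d) * real ((n - k) choose Suc d) = real (n - k - d) * real ((n - k) choose d)"
    using Suc_times_binomial_Suc_real[OF True] True assms by (simp add: of_nat_diff)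
  ultimately show ?thesis by (simp add: distrib_left del: of_nat_Suc)
next
  case False
  then show ?thesis using assms by (simp add: binomial_eq_0)
qed

lemma real_choose_two: "real (n choose 2) = real n * (real n - 1) / 2"
  using binomial_Suc_real[of 1 n] by (cases n) (auto simp: numeral_2_eq_2)

text \<open>Induction on \<open>d\<close> from the graph case \<open>d = 2\<close>. There
  Bernoulli's inequality needs an exponent of at least 1, which \<open>k \<ge> 2\<close>
  guarantees.\<close>

lemma binomial_sum_le_powr_ge2:
  assumes "2 \<le> d" "d < n" "2 \<le> k" "2 * k \<le> n"
  shows "real (k choose d) + real ((n - k) choose d)
    \<le> real (n choose d) * (1 - real d / real n) powr (real k * (real n - real k) / real n)"
  using assms(1,2)
proof (induction d rule: nat_induct_at_least)
  case base
  let ?c = "real k * (real n - real k) / real n"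
  have "real n \<le> 2 * (real n - real k)" using assms by auto
  also have "\<dots> \<le> real k * (real n - real k)"
    using assms by (intro mult_right_mono) auto
  finally have "1 \<le> ?c" using assms by simp
  then have "1 - 2 / real n * ?c \<le> (1 - 2 / real n) powr ?c"
    using assms by (intro Bernoulli_powr) auto
  then have "real (n choose 2) * (1 - 2 / real n * ?c) \<le> real (n choose 2) * (1 - 2 / real n) powr ?c"
    by (intro mult_left_mono) auto
  \<comment> \<open>Exactly \<open>k (n - k)\<close> pairs are cut; discounting them by
    \<open>(n - 1)/n\<close> gives the linearised bound.\<close>
  moreover have "real (k choose 2) + real ((n - k) choose 2) \<le> real (n choose 2) * (1 - 2 / real n * ?c)"
  proof -
    have "real (k choose 2) + real ((n - k) choose 2)
        = real n * (real n - 1) / 2 - real k * (real n - real k)"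
      using assms by (simp add: real_choose_two of_nat_diff field_simps)
    also have "\<dots> \<le> real n * (real n - 1) / 2 - real k * (real n - real k) * ((real n - 1) / real n)"
      using assms mult_left_mono[of "(real n - 1) / real n" 1 "real k * (real n - real k)"] by simp
    also have "\<dots> = real (n choose 2) * (1 - 2 / real n * ?c)"
      using assms by (simp add: real_choose_two field_simps)
    finally show ?thesis .
  qed
  ultimately show ?case by simp
next
  case (Suc d)
  let ?c = "real k * (real n - real k) / real n"
  \<comment> \<open>\<open>?r\<close> is the factor that takes \<open>1 - d/n\<close> to
    \<open>1 - (d + 1)/n\<close>.\<close>
  let ?q = "1 - real d / real n" and ?r = "1 - 1 / (real n - real d)"
  have nd: "1 < real n - real d" using Suc.prems by simp
  have r: "0 < ?r" "?r \<le> 1" using nd by auto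
  have q: "0 < ?q" using Suc.prems by simp
  have c: "?c \<le> real k"
    using assms by (simp add: field_simps)
  \<comment> \<open>The left side governs the growth of the sum of binomials, the right side that of
    the bound. Bernoulli gives it with exponent \<open>k\<close>, and \<open>?c \<le> k\<close> lets
    the exponent drop to \<open>?c\<close>.\<close>
  have "real (n - k - d) \<le> (real n - real d) * ?r ^ k"
  proof (cases "k + d \<le> n")
    case True
    have "1 - real k / (real n - real d) \<le> ?r ^ k"
      using Bernoulli_inequality[of "- 1 / (real n - real d)" k] nd by simp
    then have "(real n - real d) * (1 - real k / (real n - real d)) \<le> (real n - real d) * ?r ^ k"
      using nd by (intro mult_left_mono) auto
    moreover have "(real n - real d) * (1 - real k / (real n - real d)) = real (n - k - d)"
      using True nd by (simp add: of_nat_diff field_simps)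
    ultimately show ?thesis by simp
  next
    case False
    then have "real (n - k - d) = 0" by simp
    then show ?thesis using nd r by (metis less_eq_real_def mult_nonneg_nonneg
          zero_le_power less_trans zero_less_one)
  qed
  also have "\<dots> \<le> (real n - real d) * ?r powr ?c"
    using nd r c powr_mono'[of ?c "real k" ?r]
    by (intro mult_left_mono) (auto simp: powr_realpow)
  finally have step: "real (n - k - d) \<le> (real n - real d) * ?r powr ?c" .
  have "real (Suc d) * (real (k choose Suc d) + real ((n - k) choose Suc d))
      \<le> real (n - k - d) * (real (k choose d) + real ((n - k) choose d))"
    using Suc.prems assms by (intro binomial_sum_Suc_le) auto
  also have "\<dots> \<le> ((real n - real d) * ?r powr ?c) * (real (n choose d) * ?q powr ?c)"
    using Suc step nd by (intro mult_mono) auto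
  also have "\<dots> = ((real n - real d) * real (n choose d)) * (?q * ?r) powr ?c"
    using q r by (simp add: powr_mult)
  also have "?q * ?r = 1 - real (Suc d) / real n"
    using nd by (simp add: field_simps)
  also have "(real n - real d) * real (n choose d) = real (Suc d) * real (n choose Suc d)"
    using Suc.prems by (intro Suc_times_binomial_Suc_real[symmetric]) auto
  finally show ?case
    by (simp add: mult.assoc del: of_nat_Suc)
qed

text \<open>For \<open>k = 1\<close> the exponent \<open>(n - 1)/n\<close> is below 1, out of reach
  of Bernoulli, but the uncut fraction is then exactly \<open>q\<close>, and lowering the exponent
  of \<open>q\<close> only enlarges the bound.\<close>

lemma binomial_sum_le_powr:
  assumes "2 \<le> d" "d < n" "1 \<le> k" "2 * k \<le> n"
  shows "real (k choose d) + real ((n - k) choose d)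
    \<le> real (n choose d) * (1 - real d / real n) powr (real k * (real n - real k) / real n)"
proof (cases "k = 1")
  case True
  have q: "0 < 1 - real d / real n" using assms by simp
  have "1 choose d = 0" using assms by (intro binomial_eq_0) auto
  then have "real (k choose d) + real ((n - k) choose d) = real (n choose d) * (1 - real d / real n)"
    using binomial_pred_upper_real[of d n] assms True by simp
  also have "\<dots> \<le> real (n choose d) * (1 - real d / real n) powr (real k * (real n - real k) / real n)"
    using powr_mono'[of "real k * (real n - real k) / real n" 1 "1 - real d / real n"] q True assms
    by (intro mult_left_mono) auto
  finally show ?thesis .
next
  case False
  then show ?thesis using assms by (intro binomial_sum_le_powr_ge2) auto
qed

section \<open>Weighing the number of node sets against the uncut probability\<close>

text \<open>Take logarithms and apply \<open>ln y \<le> y - 1\<close> at \<open>y = n/k\<close>. It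
  controls the loss from the exponent \<open>k (n - k)/n\<close> being smaller than
  \<open>k\<close>.\<close>

lemma powr_ratio_le_exp_times:
  assumes "1 \<le> k" "k \<le> n"
  shows "real n powr (real k / real n) \<le> exp 1 * real k"
proof -
  have "ln (real n / real k) \<le> real n / real k - 1"
    using assms by (intro ln_le_minus_one) auto
  then have "real k / real n * ln (real n) \<le> real k / real n * (ln (real k) + real n / real k - 1)"
    using assms by (intro mult_left_mono) (auto simp: ln_div)
  also have "\<dots> = real k / real n * ln (real k) + (1 - real k / real n)"
    using assms by (simp add: field_simps)
  also have "\<dots> \<le> 1 * ln (real k) + 1"
    using assms by (intro add_mono mult_right_mono) auto
  finally have "real n powr (real k / real n) \<le> exp (ln (real k) + 1)"
    using assms by (simp add: powr_def)
  also have "\<dots> = exp 1 * real k" using assms by (simp add: exp_add)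
  finally show ?thesis .
qed

lemma power_of_powr:
  fixes z :: real
  assumes "0 < z"
  shows "(z powr a) ^ k = z powr (a * real k)"
  using assms by (simp add: powr_power mult.commute)

text \<open>Here \<open>x\<close> stands for \<open>q^m\<close>. Split the power of \<open>x\<close>
  into one of \<open>n x\<close> and one of \<open>1/n\<close>. The exponent is at least
  \<open>k/2\<close>, which gives the square root; the power of \<open>1/n\<close> is at most
  \<open>(e k)^k / n^k\<close>, hence at most \<open>e^(2k) k! / n^k\<close>, and this cancels the
  binomial.\<close>

lemma binomial_times_powr_le:
  fixes x :: real
  assumes "1 \<le> k" "2 * k \<le> n" "0 < x" "real n * x \<le> 1"
  shows "real (n choose k) * x powr (real k * (real n - real k) / real n)
    \<le> (exp 2 * sqrt (real n * x)) ^ k"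
proof -
  let ?c = "real k * (real n - real k) / real n" and ?D = "real n * x"
  have n: "0 < real n" using assms by simp
  have D: "0 < ?D" using assms n by simp
  have c: "real k / 2 \<le> ?c" using assms n by (simp add: field_simps mult_left_mono)
  have ceq: "- ?c = real k / real n * real k - real k" using n by (simp add: field_simps)
  have x: "x powr ?c = ?D powr ?c * real n powr (- ?c)"
    using assms n D by (simp add: powr_mult powr_minus field_simps)
  have "?D powr ?c \<le> ?D powr (real k / 2)"
    using D assms c by (intro powr_mono') auto
  also have "\<dots> = sqrt ?D ^ k"
    using D power_of_powr[OF D, of "1 / 2" k] by (simp add: powr_half_sqrt)
  finally have "x powr ?c \<le> sqrt ?D ^ k * real n powr (- ?c)"
    unfolding x by (intro mult_right_mono) auto
  also have "real n powr (- ?c) = (real n powr (real k / real n)) ^ k / real n ^ k"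
    unfolding ceq using n by (simp add: powr_diff powr_realpow power_of_powr)
  finally have 1: "x powr ?c \<le> sqrt ?D ^ k * ((real n powr (real k / real n)) ^ k / real n ^ k)" .
  have 2: "(real n powr (real k / real n)) ^ k \<le> (exp 1 * real k) ^ k"
    using assms by (intro power_mono powr_ratio_le_exp_times) auto
  have 3: "(exp 1 * real k) ^ k \<le> exp 2 ^ k * fact k"
  proof -
    have "(exp 1 * real k) ^ k \<le> exp 1 ^ k * (exp (real k) * fact k)"
      using power_le_exp_times_fact[of "real k" k] by (simp add: power_mult_distrib)
    also have "\<dots> = exp 2 ^ k * fact k"
      by (simp add: exp_of_nat_mult[symmetric] exp_add[symmetric])
    finally show ?thesis .
  qed
  have "real ((n choose k) * fact k) \<le> real (n ^ k)"
    using binomial_fact_pow by (intro of_nat_mono)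
  then have 4: "real (n choose k) \<le> real n ^ k / fact k"
    by (simp add: field_simps)
  have "real (n choose k) * x powr ?c
      \<le> (real n ^ k / fact k) * (sqrt ?D ^ k * ((exp 2 ^ k * fact k) / real n ^ k))"
    using 4 order_trans[OF 2 3] D n
    by (intro mult_mono order_trans[OF 1] divide_right_mono mult_left_mono) auto
  also have "\<dots> = (exp 2 * sqrt ?D) ^ k"
    using n by (simp add: power_mult_distrib)
  finally show ?thesis .
qed

subsection \<open>Counting hypergraphs\<close>

text \<open>The node set is a parameter, so that the same counts serve \<open>{1..n}\<close>, the
  complement of avoided nodes and both sides of a cut.\<close>

definition dsets :: "'a set \<Rightarrow> nat \<Rightarrow> 'a set set" where
  "dsets V d = {e. e \<subseteq> V \<and> card e = d}"

lemma finite_dsets: "finite V \<Longrightarrow> finite (dsets V d)"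
  unfolding dsets_def by (rule finite_subset[of _ "Pow V"]) auto

lemma card_dsets: "finite V \<Longrightarrow> card (dsets V d) = card V choose d"
  unfolding dsets_def by (rule n_subsets)

lemma hypergraphs_eq: "hypergraphs n m d = {E. E \<subseteq> dsets {1..n} d \<and> card E = m}"
  unfolding hypergraphs_def dsets_def ..

lemma finite_hypergraphs: "finite (hypergraphs n m d)"
  unfolding hypergraphs_eq
  by (rule finite_subset[of _ "Pow (dsets {1..n} d)"]) (auto intro: finite_dsets)

lemma card_hypergraphs: "card (hypergraphs n m d) = (n choose d) choose m"
  unfolding hypergraphs_eq by (simp add: n_subsets finite_dsets card_dsets)

lemma prob_connected_eq:
  assumes "m \<le> n choose d"
  shows "prob_connected n m d
    = real (card {E \<in> hypergraphs n m d. hg_connected {1..n} E}) / real ((n choose d) choose m)"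
proof -
  have "0 < card (hypergraphs n m d)" using assms by (simp add: card_hypergraphs)
  then have "hypergraphs n m d \<noteq> {}" by auto
  then show ?thesis
    unfolding prob_connected_def
    by (simp add: measure_pmf_of_set finite_hypergraphs card_hypergraphs Collect_conj_eq)
qed

lemma card_hypergraphs_avoiding:
  assumes "W \<subseteq> {1..n}"
  shows "card {E \<in> hypergraphs n m d. \<Union>E \<inter> W = {}} = ((n - card W) choose d) choose m"
proof -
  have "{E \<in> hypergraphs n m d. \<Union>E \<inter> W = {}}
      = {E. E \<subseteq> dsets ({1..n} - W) d \<and> card E = m}"
    unfolding hypergraphs_eq dsets_def by blast
  moreover have "card ({1..n} - W) = n - card W"
    using assms by (simp add: card_Diff_subset finite_subset)
  ultimately show ?thesis by (simp add: n_subsets finite_dsets card_dsets)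
qed

section \<open>Isolated nodes and the second moment\<close>

text \<open>Chebyshev's inequality in terms of counts. \<open>X E\<close> is the number of
  \<open>v\<close> related to \<open>E\<close>, with mean \<open>\<mu>\<close>; negative
  correlation, the hypothesis \<open>cor\<close>, bounds its variance by \<open>\<mu>\<close>, so
  \<open>X\<close> vanishes with probability at most \<open>1/\<mu>\<close>.\<close>

lemma second_moment_count:
  fixes R :: "'e \<Rightarrow> 'v \<Rightarrow> bool"
  assumes fin: "finite H" "finite V" and pos: "0 < card H" "0 < card V" "0 < a"
    and one: "\<And>v. v \<in> V \<Longrightarrow> card {E \<in> H. R E v} = a"
    and two: "\<And>v w. v \<in> V \<Longrightarrow> w \<in> V \<Longrightarrow> v \<noteq> w \<Longrightarrow> card {E \<in> H. R E v \<and> R E w} = b"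
    and cor: "real b * real (card H) \<le> (real a)\<^sup>2"
  shows "real (card {E \<in> H. \<forall>v\<in>V. \<not> R E v}) / real (card H)
    \<le> real (card H) / (real (card V) * real a)"
proof -
  define X where "X E = (\<Sum>v\<in>V. of_bool (R E v) :: real)" for E
  define h n where "h = real (card H)" and "n = real (card V)"
  define \<mu> where "\<mu> = n * real a / h"
  let ?Z = "{E \<in> H. \<forall>v\<in>V. \<not> R E v}"
  have h: "0 < h" and n: "0 < n" using pos by (auto simp: h_def n_def)
  have count: "(\<Sum>E\<in>H. of_bool (P E) :: real) = real (card {E \<in> H. P E})" for P
    using fin by (simp add: of_bool_def sum.If_cases Int_def)
  have "(\<Sum>E\<in>H. X E) = (\<Sum>v\<in>V. \<Sum>E\<in>H. of_bool (R E v))"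
    unfolding X_def by (rule sum.swap)
  also have "\<dots> = n * real a"
    by (simp add: count one n_def)
  finally have m1: "(\<Sum>E\<in>H. X E) = n * real a" .
  have "(\<Sum>E\<in>H. (X E)\<^sup>2) = (\<Sum>E\<in>H. \<Sum>v\<in>V. \<Sum>w\<in>V. of_bool (R E v \<and> R E w))"
    unfolding X_def power2_eq_square sum_product by (intro sum.cong refl) auto
  also have "\<dots> = (\<Sum>v\<in>V. \<Sum>E\<in>H. \<Sum>w\<in>V. of_bool (R E v \<and> R E w))"
    by (rule sum.swap)
  also have "\<dots> = (\<Sum>v\<in>V. \<Sum>w\<in>V. \<Sum>E\<in>H. of_bool (R E v \<and> R E w))"
    by (intro sum.cong refl sum.swap)
  also have "\<dots> = (\<Sum>v\<in>V. \<Sum>w\<in>V. real (card {E \<in> H. R E v \<and> R E w}))"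
    by (simp only: count)
  \<comment> \<open>Adding \<open>b\<close> on the diagonal as well costs little and makes the
    double sum uniform.\<close>
  also have "\<dots> \<le> (\<Sum>v\<in>V. \<Sum>w\<in>V. (if w = v then real a else 0) + real b)"
    by (intro sum_mono) (auto simp: one two)
  also have "\<dots> = n * real a + n\<^sup>2 * real b"
    using fin by (simp add: sum.distrib n_def power2_eq_square algebra_simps)
  finally have m2: "(\<Sum>E\<in>H. (X E)\<^sup>2) \<le> n * real a + n\<^sup>2 * real b" .
  \<comment> \<open>On \<open>?Z\<close> the count \<open>X E\<close> is zero, so each member
    deviates from the mean by exactly \<open>\<mu>\<close>.\<close>
  have "real (card ?Z) * \<mu>\<^sup>2 = (\<Sum>E\<in>?Z. (X E - \<mu>)\<^sup>2)"
    by (simp add: X_def)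
  also have "\<dots> \<le> (\<Sum>E\<in>H. (X E - \<mu>)\<^sup>2)"
    using fin by (intro sum_mono2) auto
  also have "\<dots> = (\<Sum>E\<in>H. (X E)\<^sup>2) - 2 * \<mu> * (\<Sum>E\<in>H. X E) + h * \<mu>\<^sup>2"
    by (simp add: power2_diff sum.distrib sum_subtractf sum_distrib_left sum_distrib_right h_def mult_ac)
  also have "\<dots> \<le> n * real a + n\<^sup>2 * real b - h * \<mu>\<^sup>2"
  proof -
    have "2 * \<mu> * (\<Sum>E\<in>H. X E) = 2 * (h * \<mu>\<^sup>2)"
      using h unfolding m1 \<mu>_def by (simp add: power2_eq_square field_simps)
    then show ?thesis using m2 by linarith
  qed
  also have "\<dots> \<le> n * real a"
  proof -
    have "n\<^sup>2 * (real b * h) \<le> n\<^sup>2 * (real a)\<^sup>2"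
      using cor unfolding h_def by (intro mult_left_mono) auto
    then show ?thesis
      using h unfolding \<mu>_def by (simp add: power2_eq_square field_simps)
  qed
  finally have "real (card ?Z) * \<mu>\<^sup>2 \<le> n * real a" .
  then have "real (card ?Z) * (n * real a) * (n * real a) \<le> h\<^sup>2 * (n * real a)"
    using h unfolding \<mu>_def by (simp add: power2_eq_square field_simps)
  then have "real (card ?Z) * (n * real a) \<le> h\<^sup>2"
    using n pos by (subst (asm) mult_le_cancel_right_pos) auto
  then show ?thesis
    using h n pos unfolding h_def[symmetric] n_def[symmetric]
    by (simp add: power2_eq_square field_simps)
qed

text \<open>An isolated \<open>v\<close> would be separated from the other nodes, which exist since
  \<open>n \<ge> 2\<close>.\<close>

lemma connected_imp_covered:
  fixes E :: "nat set set"
  assumes "hg_connected {1..n} E" "2 \<le> n" "v \<in> {1..n}"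
  shows "v \<in> \<Union>E"
proof -
  have "card ({1..n} - {v}) \<noteq> 0" using assms by simp
  then have "{1..n} - {v} \<noteq> {}" by (metis card.empty)
  then have "\<exists>e\<in>E. e \<inter> {v} \<noteq> {} \<and> e \<inter> ({1..n} - {v}) \<noteq> {}"
    using assms unfolding hg_connected_def by (metis Diff_disjoint empty_not_insert
        Un_Diff_cancel insert_is_Un insert_absorb)
  then show ?thesis by auto
qed

text \<open>A connected hypergraph has no isolated node, so the second moment bound applies with
  \<open>v \<notin> \<Union>E\<close> as the relation. The denominator is a lower bound for the
  expected number of isolated nodes.\<close>

lemma prob_connected_le:
  assumes "2 \<le> d" "d < n" "(real m)\<^sup>2 < real ((n - 1) choose d)"
  shows "prob_connected n m d
    \<le> 1 / (real n * (1 - real d / real n) ^ m * (1 - (real m)\<^sup>2 / real ((n - 1) choose d)))"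
proof -
  let ?M = "(n - 1) choose d" and ?N = "n choose d" and ?H = "hypergraphs n m d"
  let ?q = "1 - real d / real n"
  let ?h = "real (?N choose m)" and ?a = "real (?M choose m)"
  have q: "0 < ?q" using assms by simp
  have "real m \<le> (real m)\<^sup>2" by (cases m) (auto simp: power2_eq_square)
  then have mM: "m \<le> ?M" using assms(3) by linarith
  have M: "0 < ?M" using assms by simp
  have MN: "?M \<le> ?N" by (rule binomial_mono_upper) simp
  then have mN: "m \<le> ?N" using mM by simp
  have h: "0 < ?h" and a: "0 < ?a" using mM mN by auto
  have cor: "real (((n - 2) choose d) choose m) * ?h \<le> ?a\<^sup>2"
    using assms MN
    by (intro binomial_upper_log_concave binomial_pred_pred_log_concave
        binomial_pred_pred_convex binomial_mono_upper) auto
  have "real (card {E \<in> ?H. \<forall>v\<in>{1..n}. \<not> v \<notin> \<Union>E}) / real (card ?H)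
      \<le> real (card ?H) / (real (card {1..n}) * ?a)"
  proof (rule second_moment_count[where b = "((n - 2) choose d) choose m"])
    show "card {E \<in> ?H. v \<notin> \<Union>E} = ?M choose m" if "v \<in> {1..n}" for v
      using card_hypergraphs_avoiding[of "{v}" n m d] that by simp
    show "card {E \<in> ?H. v \<notin> \<Union>E \<and> w \<notin> \<Union>E} = ((n - 2) choose d) choose m"
      if "v \<in> {1..n}" "w \<in> {1..n}" "v \<noteq> w" for v w
      using card_hypergraphs_avoiding[of "{v, w}" n m d] that by (simp add: numeral_2_eq_2)
  qed (use assms h a cor in \<open>auto simp: finite_hypergraphs card_hypergraphs\<close>)
  then have 1: "real (card {E \<in> ?H. \<forall>v\<in>{1..n}. \<not> v \<notin> \<Union>E}) / ?h \<le> ?h / (real n * ?a)"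
    by (simp add: card_hypergraphs)
  have "card {E \<in> ?H. hg_connected {1..n} E} \<le> card {E \<in> ?H. \<forall>v\<in>{1..n}. \<not> v \<notin> \<Union>E}"
    using assms connected_imp_covered[of n]
    by (intro card_mono) (auto simp: finite_hypergraphs simp del: Union_iff)
  then have "prob_connected n m d \<le> real (card {E \<in> ?H. \<forall>v\<in>{1..n}. \<not> v \<notin> \<Union>E}) / ?h"
    unfolding prob_connected_eq[OF mN] by (intro divide_right_mono) auto
  also note 1
  also have "?h / (real n * ?a) \<le> ?h / (real n * (?h * ?q ^ m * (1 - (real m)\<^sup>2 / real ?M)))"
  proof (intro divide_left_mono mult_left_mono binomial_ratio_ge_power)
    show "0 < real n * ?a * (real n * (?h * ?q ^ m * (1 - (real m)\<^sup>2 / real ?M)))"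
      using assms q h a M by (intro mult_pos_pos zero_less_power) auto
  qed (use assms q h a M mM MN binomial_pred_upper_real[of d n] in auto)
  also have "\<dots> = 1 / (real n * ?q ^ m * (1 - (real m)\<^sup>2 / real ?M))"
    using h by simp
  finally show ?thesis .
qed

section \<open>Uncut node sets and the union bound\<close>

text \<open>Take \<open>S\<close> to be the smaller class of a partition that no edge crosses; every
  edge then lies in \<open>S\<close> or in its complement.\<close>

lemma disconnected_subset:
  "{E \<in> hypergraphs n m d. \<not> hg_connected {1..n} E}
    \<subseteq> (\<Union>k\<in>{1..n div 2}. \<Union>S\<in>dsets {1..n} k.
          {E. E \<subseteq> dsets S d \<union> dsets ({1..n} - S) d \<and> card E = m})"
proof
  fix E assume E: "E \<in> {E \<in> hypergraphs n m d. \<not> hg_connected {1..n} E}"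
  then obtain V1 V2 where V: "V1 \<noteq> {}" "V2 \<noteq> {}" "V1 \<union> V2 = {1..n}" "V1 \<inter> V2 = {}"
    "\<forall>e\<in>E. e \<inter> V1 = {} \<or> e \<inter> V2 = {}"
    by (auto simp: hg_connected_def)
  have fin: "finite V1" "finite V2"
    using V(3) by (metis finite_Un finite_atLeastAtMost)+
  have sum: "card V1 + card V2 = n"
    using card_Un_disjoint[OF fin V(4)] V(3) by simp
  obtain S T where S: "S \<noteq> {}" "S \<union> T = {1..n}" "S \<inter> T = {}" "2 * card S \<le> n"
    "\<forall>e\<in>E. e \<inter> S = {} \<or> e \<inter> T = {}" "finite S"
  proof (cases "2 * card V1 \<le> n")
    case True
    then show ?thesis using that[of V1 V2] V fin by blast
  next
    case False
    then show ?thesis using that[of V2 V1] V fin sum by (simp add: Un_commute Int_commute) blast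
  qed
  have E': "e \<subseteq> {1..n}" "card e = d" if "e \<in> E" for e
    using E that unfolding hypergraphs_def by auto
  have "e \<in> dsets S d \<union> dsets ({1..n} - S) d" if "e \<in> E" for e
  proof (cases "e \<inter> S = {}")
    case True
    then show ?thesis using E'[OF that] by (auto simp: dsets_def)
  next
    case False
    then have "e \<inter> T = {}" using S(5) that by blast
    then have "e \<subseteq> S" using E'(1)[OF that] S(2) by blast
    then show ?thesis using E'[OF that] by (simp add: dsets_def)
  qed
  moreover have "card E = m" using E unfolding hypergraphs_def by simp
  ultimately have "E \<subseteq> dsets S d \<union> dsets ({1..n} - S) d \<and> card E = m" by auto
  moreover have "S \<in> dsets {1..n} (card S)" using S unfolding dsets_def by auto
  moreover have "card S \<in> {1..n div 2}"
    using S by (auto simp: Suc_le_eq card_gt_0_iff)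
  ultimately show "E \<in> (\<Union>k\<in>{1..n div 2}. \<Union>S\<in>dsets {1..n} k.
          {E. E \<subseteq> dsets S d \<union> dsets ({1..n} - S) d \<and> card E = m})"
    by blast
qed

text \<open>The edges that do not cut \<open>S\<close> form at most a fraction
  \<open>q powr (k (n - k)/n)\<close> of all \<open>d\<close>-sets, and choosing \<open>m\<close>
  distinct edges among them costs at most the \<open>m\<close>-th power of that fraction.\<close>

lemma card_uncut_hypergraphs_le:
  assumes "2 \<le> d" "d < n" "1 \<le> k" "2 * k \<le> n" "S \<in> dsets {1..n} k"
  shows "real (card {E. E \<subseteq> dsets S d \<union> dsets ({1..n} - S) d \<and> card E = m})
    \<le> real ((n choose d) choose m)
        * ((1 - real d / real n) ^ m) powr (real k * (real n - real k) / real n)"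
proof -
  let ?D = "dsets S d \<union> dsets ({1..n} - S) d" and ?N = "n choose d"
  let ?q = "1 - real d / real n" and ?c = "real k * (real n - real k) / real n"
  have S: "S \<subseteq> {1..n}" "card S = k" using assms(5) by (auto simp: dsets_def)
  then have finS: "finite S" by (auto intro: finite_subset)
  have finD: "finite ?D" using finS by (auto intro: finite_dsets)
  have cT: "card ({1..n} - S) = n - k" using S finS by (simp add: card_Diff_subset)
  have "?D \<subseteq> dsets {1..n} d" using S by (auto simp: dsets_def)
  then have "card ?D \<le> card (dsets {1..n} d)" by (intro card_mono finite_dsets) auto
  then have DN: "card ?D \<le> ?N" by (simp add: card_dsets)
  have N: "0 < real ?N" using assms by simp
  have q: "0 < ?q" using assms by simp
  have "card ?D \<le> (k choose d) + ((n - k) choose d)"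
    using card_Un_le[of "dsets S d" "dsets ({1..n} - S) d"] finS S cT by (simp add: card_dsets)
  then have "real (card ?D) \<le> real (k choose d) + real ((n - k) choose d)" by linarith
  also have "\<dots> \<le> real ?N * ?q powr ?c" using assms by (intro binomial_sum_le_powr)
  finally have "real (card ?D) ^ m \<le> (real ?N * ?q powr ?c) ^ m"
    by (intro power_mono) auto
  also have "\<dots> = real ?N ^ m * (?q ^ m) powr ?c"
    using q by (simp add: power_mult_distrib power_of_powr powr_powr mult.commute
        flip: powr_realpow)
  finally have D: "real (card ?D) ^ m \<le> real ?N ^ m * (?q ^ m) powr ?c" .
  have "real (card ?D choose m) * real ?N ^ m \<le> real (?N choose m) * real (card ?D) ^ m"
    by (rule binomial_ratio_le_power[OF DN])
  also have "\<dots> \<le> real (?N choose m) * (real ?N ^ m * (?q ^ m) powr ?c)"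
    by (intro mult_left_mono D) auto
  finally have "real (card ?D choose m) \<le> real (?N choose m) * (?q ^ m) powr ?c"
    using N by (simp add: mult_ac)
  then show ?thesis using finD by (simp add: n_subsets)
qed

text \<open>Sum the uncut bound over all \<open>S\<close> of size \<open>k\<close>, then over
  \<open>k\<close>: the terms are at most \<open>r^k\<close>, and the series starts at
  \<open>k = 1\<close>, whence \<open>r / (1 - r)\<close>.\<close>

lemma prob_connected_ge:
  assumes "2 \<le> d" "d < n" "m \<le> n choose d"
    and x: "x = real n * (1 - real d / real n) ^ m" "x \<le> 1"
    and r: "r = exp 2 * sqrt x" "r < 1"
  shows "1 - r / (1 - r) \<le> prob_connected n m d"
proof -
  let ?N = "n choose d" and ?H = "hypergraphs n m d" and ?V = "{1..n}"
  let ?h = "real (?N choose m)"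
  let ?q = "1 - real d / real n" and ?c = "\<lambda>k. real k * (real n - real k) / real n"
  let ?U = "\<lambda>S. {E. E \<subseteq> dsets S d \<union> dsets (?V - S) d \<and> card E = m}"
  have h: "0 < ?h" using assms by simp
  have q: "0 < ?q" using assms by simp
  have r0: "0 \<le> r" using r x q by simp
  have finU: "finite (?U S)" if "S \<in> dsets ?V k" for S k
  proof -
    have "finite S" using that by (auto simp: dsets_def intro: finite_subset)
    then show ?thesis
      by (rule_tac finite_subset[of _ "Pow (dsets S d \<union> dsets (?V - S) d)"])
        (auto intro: finite_dsets)
  qed
  have "card {E \<in> ?H. \<not> hg_connected ?V E} \<le> card (\<Union>k\<in>{1..n div 2}. \<Union>S\<in>dsets ?V k. ?U S)"
    using finU by (intro card_mono disconnected_subset) (auto intro!: finite_UN_I finite_dsets)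
  also have "\<dots> \<le> (\<Sum>k\<in>{1..n div 2}. card (\<Union>S\<in>dsets ?V k. ?U S))"
    by (intro card_UN_le) auto
  also have "\<dots> \<le> (\<Sum>k\<in>{1..n div 2}. \<Sum>S\<in>dsets ?V k. card (?U S))"
    by (intro sum_mono card_UN_le finite_dsets) auto
  finally have "real (card {E \<in> ?H. \<not> hg_connected ?V E})
      \<le> (\<Sum>k\<in>{1..n div 2}. \<Sum>S\<in>dsets ?V k. real (card (?U S)))"
    by (metis (mono_tags, lifting) of_nat_le_iff of_nat_sum sum.cong)
  also have "\<dots> \<le> (\<Sum>k\<in>{1..n div 2}. \<Sum>S\<in>dsets ?V k. ?h * (?q ^ m) powr ?c k)"
    using assms by (intro sum_mono card_uncut_hypergraphs_le) auto
  also have "\<dots> = (\<Sum>k\<in>{1..n div 2}. ?h * (real (n choose k) * (?q ^ m) powr ?c k))"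
    by (simp add: card_dsets mult_ac)
  also have "\<dots> \<le> (\<Sum>k\<in>{1..n div 2}. ?h * r ^ k)"
    unfolding r(1) x(1) using assms q
    by (intro sum_mono mult_left_mono binomial_times_powr_le) auto
  also have "\<dots> = ?h * (\<Sum>k=1..n div 2. r ^ k)" by (simp add: sum_distrib_left)
  also have "\<dots> \<le> ?h * (r / (1 - r))"
  proof (intro mult_left_mono)
    have "(\<Sum>k=1..n div 2. r ^ k) = (\<Sum>k<n div 2. r * r ^ k)"
      by (rule sum.reindex_bij_witness[of _ Suc "\<lambda>k. k - 1"])
        (auto simp flip: power_Suc)
    also have "\<dots> \<le> (\<Sum>k. r * r ^ k)"
      using r0 r(2) by (intro sum_le_suminf summable_mult summable_geometric) auto
    also have "\<dots> = r / (1 - r)"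
      using r0 r(2) by (subst suminf_mult) (auto simp: suminf_geometric summable_geometric)
    finally show "(\<Sum>k=1..n div 2. r ^ k) \<le> r / (1 - r)" .
  qed simp
  finally have dis: "real (card {E \<in> ?H. \<not> hg_connected ?V E}) \<le> ?h * (r / (1 - r))" .
  have "card ?H = card ({E \<in> ?H. hg_connected ?V E} \<union> {E \<in> ?H. \<not> hg_connected ?V E})"
    by (intro arg_cong[of _ _ card]) blast
  also have "\<dots> = card {E \<in> ?H. hg_connected ?V E} + card {E \<in> ?H. \<not> hg_connected ?V E}"
    by (intro card_Un_disjoint) (auto simp: finite_hypergraphs)
  finally have "card ?H = card {E \<in> ?H. hg_connected ?V E} + card {E \<in> ?H. \<not> hg_connected ?V E}" .
  then have "?h = real (card {E \<in> ?H. hg_connected ?V E}) + real (card {E \<in> ?H. \<not> hg_connected ?V E})"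
    by (simp add: card_hypergraphs)
  then have "?h * (1 - r / (1 - r)) \<le> real (card {E \<in> ?H. hg_connected ?V E})"
    using dis by (simp add: algebra_simps)
  then show ?thesis
    unfolding prob_connected_eq[OF assms(3)] using h by (simp add: field_simps)
qed

subsection \<open>Asymptotics\<close>

text \<open>One of \<open>d\<close> and \<open>n - d\<close> lies between 2 and \<open>n/2\<close>,
  where binomials increase; symmetry handles the other case.\<close>

lemma choose_two_le_choose:
  assumes "2 \<le> d" "d + 2 \<le> n"
  shows "n choose 2 \<le> n choose d"
proof (cases "2 * d \<le> n")
  case True
  then show ?thesis using assms by (intro binomial_mono) auto
next
  case False
  then have "n choose 2 \<le> n choose (n - d)" using assms by (intro binomial_mono) auto
  then show ?thesis using assms binomial_symmetric[of d n] by simp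
qed

text \<open>From \<open>m = 3\<close> on the square at most doubles at each step. The factor 2
  accommodates \<open>m = 3\<close>, where 9 exceeds 8.\<close>

lemma square_le_two_power: "m\<^sup>2 \<le> 2 * 2 ^ m" for m :: nat
proof (induction m)
  case (Suc m)
  show ?case
  proof (cases "3 \<le> m")
    case True
    then have "3 * m \<le> m * m" by simp
    moreover have "Suc (m + m) \<le> 3 * m" using True by simp
    ultimately have "Suc (m + m) \<le> m * m" by (rule order_trans[rotated])
    then have "(Suc m)\<^sup>2 \<le> 2 * m\<^sup>2" unfolding power2_eq_square by simp
    with Suc show ?thesis by simp
  next
    case False
    then have "m = 0 \<or> m = 1 \<or> m = 2" by auto
    then show ?thesis by (auto simp: power2_eq_square)
  qed
qed simp

text \<open>The denominator is \<open>q N\<close>. For \<open>q \<ge> 1/2\<close> it is at least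
  \<open>N/2\<close>, which gives the first summand. For smaller \<open>q\<close>, a large
  \<open>x\<close> forces \<open>m\<close> to be logarithmic in \<open>n\<close> and
  \<open>q N\<close> to be at least \<open>x n / 4\<close>, which gives the second.\<close>

lemma square_over_pred_binomial_le:
  assumes "2 \<le> d" "d < n" "1 \<le> m"
    and x: "x = real n * (1 - real d / real n) ^ m" "2 \<le> x"
  shows "(real m)\<^sup>2 / real ((n - 1) choose d) \<le> 2 * ((real m)\<^sup>2 / real (n choose d)) + 8 / x"
proof -
  let ?q = "1 - real d / real n" and ?N = "real (n choose d)"
  have q: "0 < ?q" "?q \<le> 1" using assms by auto
  have N: "0 < ?N" using assms by simp
  have M: "real ((n - 1) choose d) = ?q * ?N"
    using assms by (intro binomial_pred_upper_real) auto
  show ?thesis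
  proof (cases "1 / 2 \<le> ?q")
    case True
    have "(real m)\<^sup>2 / (?q * ?N) \<le> (real m)\<^sup>2 / (1 / 2 * ?N)"
      using True N q by (intro divide_left_mono mult_right_mono mult_pos_pos) auto
    also have "\<dots> = 2 * ((real m)\<^sup>2 / ?N)" by simp
    also have "\<dots> \<le> 2 * ((real m)\<^sup>2 / ?N) + 8 / x" using x(2) by simp
    finally show ?thesis unfolding M .
  next
    case False
    \<comment> \<open>As \<open>m \<ge> 1\<close>, \<open>x\<close> is at most
      \<open>n q = n - d\<close>; hence \<open>x \<ge> 2\<close> keeps \<open>d\<close> two away
      from \<open>n\<close>, as the comparison with \<open>n choose 2\<close> requires.\<close>
    have "?q ^ m \<le> ?q ^ 1" using q assms by (intro power_decreasing) auto
    then have xq: "x \<le> real n * ?q" unfolding x by (intro mult_left_mono) auto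
    also have "real n * ?q = real n - real d" using assms by (simp add: field_simps)
    finally have "d + 2 \<le> n" using x(2) by linarith
    then have "real (n choose 2) \<le> ?N" using assms by (intro of_nat_mono choose_two_le_choose)
    moreover have "real n * real n / 4 \<le> real (n choose 2)"
      using assms by (simp add: real_choose_two mult_left_mono)
    ultimately have "?q * (real n * real n / 4) \<le> ?q * ?N"
      using q by (intro mult_left_mono) auto
    moreover have "x * (real n / 4) \<le> (real n * ?q) * (real n / 4)"
      using xq by (intro mult_right_mono) auto
    ultimately have low: "x * real n / 4 \<le> ?q * ?N" by (simp add: mult_ac)
    have "?q ^ m \<le> (1 / 2) ^ m" using False q by (intro power_mono) auto
    then have "real n * ?q ^ m \<le> real n * (1 / 2) ^ m" by (intro mult_left_mono) auto
    then have "1 \<le> real n * (1 / 2) ^ m" using x by simp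
    then have two: "2 ^ m \<le> real n" by (simp add: power_divide field_simps)
    have "real (m\<^sup>2) \<le> real (2 * 2 ^ m)"
      by (intro of_nat_mono square_le_two_power)
    then have "(real m)\<^sup>2 \<le> 2 * 2 ^ m" by simp
    with two have "(real m)\<^sup>2 \<le> 2 * real n" by linarith
    then have "(real m)\<^sup>2 / (?q * ?N) \<le> 2 * real n / (x * real n / 4)"
      using low x assms by (intro frac_le) auto
    also have "\<dots> = 8 / x" using assms by simp
    also have "\<dots> \<le> 2 * ((real m)\<^sup>2 / ?N) + 8 / x" by simp
    finally show ?thesis unfolding M .
  qed
qed

text \<open>Since \<open>q > 0\<close>, the finite branch of \<open>thr\<close> applies and the two
  logarithms merge.\<close>

lemma thr_eq_ln:
  assumes "d < n"
  shows "thr n m d = ereal (ln (real n * (1 - real d / real n) ^ m))"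
    and "0 < real n * (1 - real d / real n) ^ m"
proof -
  have q: "0 < 1 - real d / real n" using assms by simp
  then show "0 < real n * (1 - real d / real n) ^ m" using assms by simp
  show "thr n m d = ereal (ln (real n * (1 - real d / real n) ^ m))"
    using assms q by (simp add: thr_def ln_mult ln_realpow)
qed

theorem mainTheorem2:
  fixes m d :: "nat \<Rightarrow> nat"
  assumes m_pos: "\<forall>\<^sub>F n in sequentially. m n \<ge> 1"
      and d_range: "\<forall>\<^sub>F n in sequentially. 2 \<le> d n \<and> d n \<le> n"
      and m_small: "(\<lambda>n. real (m n)) \<in> o(\<lambda>n. sqrt (real (n choose d n)))"
  shows "((\<lambda>n. thr n (m n) (d n)) \<longlonglongrightarrow> \<infinity> \<longrightarrow>
            (\<lambda>n. prob_connected n (m n) (d n)) \<longlonglongrightarrow> 0)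
       \<and> ((\<lambda>n. thr n (m n) (d n)) \<longlonglongrightarrow> -\<infinity> \<longrightarrow>
            (\<lambda>n. prob_connected n (m n) (d n)) \<longlonglongrightarrow> 1)"
proof -
  define x where "x n = real n * (1 - real (d n) / real n) ^ m n" for n
  have lim: "(\<lambda>n. real (m n) / sqrt (real (n choose d n))) \<longlonglongrightarrow> 0"
    using smalloD_tendsto[OF m_small] .
  have sq: "(\<lambda>n. (real (m n))\<^sup>2 / real (n choose d n)) \<longlonglongrightarrow> 0"
    using tendsto_power[OF lim, of 2] by (simp add: power_divide)
  have "\<forall>\<^sub>F n in sequentially. real (m n) / sqrt (real (n choose d n)) < 1"
    using order_tendstoD(2)[OF lim, of 1] by simp
  \<comment> \<open>The case \<open>d = n\<close> dies out, since \<open>N = 1\<close> would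
    contradict \<open>1 \<le> m < sqrt N\<close>. Moreover \<open>m \<le> N\<close> makes the sample
    space nonempty.\<close>
  with m_pos d_range have regime: "\<forall>\<^sub>F n in sequentially.
      1 \<le> m n \<and> 2 \<le> d n \<and> d n < n \<and> m n \<le> n choose d n"
  proof eventually_elim
    case (elim n)
    let ?N = "n choose d n"
    have N: "1 \<le> ?N" using elim by (simp add: Suc_le_eq)
    then have lt: "real (m n) < sqrt (real ?N)" using elim by (simp add: field_simps)
    have "sqrt (real ?N) \<le> real ?N"
      using N by (intro real_le_lsqrt self_le_power) auto
    moreover have "d n \<noteq> n" using lt elim by auto
    ultimately show ?case using lt elim by auto
  qed
  have nn: "0 \<le> prob_connected n (m n) (d n)" and le1: "prob_connected n (m n) (d n) \<le> 1" for n
    unfolding prob_connected_def by auto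
  have "(\<lambda>n. prob_connected n (m n) (d n)) \<longlonglongrightarrow> 0"
    if thr: "(\<lambda>n. thr n (m n) (d n)) \<longlonglongrightarrow> \<infinity>"
  proof -
    have x: "filterlim x at_top sequentially"
      unfolding filterlim_at_top
    proof
      fix Z :: real
      have "\<forall>\<^sub>F n in sequentially. ereal Z < thr n (m n) (d n)"
        using thr unfolding tendsto_PInfty by simp
      with regime show "\<forall>\<^sub>F n in sequentially. Z \<le> x n"
      proof eventually_elim
        case (elim n)
        then have "Z < ln (x n)" "0 < x n"
          using thr_eq_ln[of "d n" n "m n"] by (auto simp: x_def)
        \<comment> \<open>\<open>ln x \<le> x - 1\<close> lets the bound \<open>Z\<close> on the
          logarithm pass to \<open>x\<close> itself, without exponentiating.\<close>
        then show ?case using ln_le_minus_one[of "x n"] by linarith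
      qed
    qed
    \<comment> \<open>\<open>b\<close> bounds the relative error in the expected number of isolated
      nodes; once it is below 1/2, that expectation is at least \<open>x/2\<close>.\<close>
    define b where "b n = 2 * ((real (m n))\<^sup>2 / real (n choose d n)) + 8 / x n" for n
    have "(\<lambda>n. 8 / x n) \<longlonglongrightarrow> 0"
      by (rule real_tendsto_divide_at_top[OF tendsto_const x])
    then have b: "b \<longlonglongrightarrow> 0"
      unfolding b_def using tendsto_add[OF tendsto_mult[OF tendsto_const[of 2] sq]] by simp
    have "\<forall>\<^sub>F n in sequentially. b n < 1 / 2"
      using order_tendstoD(2)[OF b, of "1 / 2"] by simp
    moreover have "\<forall>\<^sub>F n in sequentially. 2 \<le> x n"
      using x unfolding filterlim_at_top by simp
    ultimately have "\<forall>\<^sub>F n in sequentially. prob_connected n (m n) (d n) \<le> 2 / x n"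
      using regime
    proof eventually_elim
      case (elim n)
      let ?M = "real ((n - 1) choose d n)" and ?s = "(real (m n))\<^sup>2"
      have "?s / ?M \<le> b n"
        unfolding b_def using elim by (intro square_over_pred_binomial_le) (auto simp: x_def)
      then have s: "?s / ?M < 1 / 2" using elim(1) by linarith
      have M: "0 < ?M" using elim by auto
      have s1: "?s / ?M < 1" using s by linarith
      then have "?s < ?M" using M by (simp only: divide_less_eq_1_pos)
      then have "prob_connected n (m n) (d n) \<le> 1 / (x n * (1 - ?s / ?M))"
        using prob_connected_le[of "d n" n "m n"] elim by (simp add: x_def)
      also have "\<dots> \<le> 1 / (x n * (1 / 2))"
      proof (intro divide_left_mono mult_left_mono mult_pos_pos)
        show "1 / 2 \<le> 1 - ?s / ?M" "0 < 1 - ?s / ?M" using s s1 by linarith+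
      qed (use elim in auto)
      finally show ?case by simp
    qed
    from tendsto_sandwich[OF always_eventually[OF allI[OF nn]] this tendsto_const
        real_tendsto_divide_at_top[OF tendsto_const x]]
    show ?thesis .
  qed
  moreover have "(\<lambda>n. prob_connected n (m n) (d n)) \<longlonglongrightarrow> 1"
    if thr: "(\<lambda>n. thr n (m n) (d n)) \<longlonglongrightarrow> -\<infinity>"
  proof -
    have x: "x \<longlonglongrightarrow> 0"
    proof (rule tendstoI)
      fix e :: real assume e: "0 < e"
      have "\<forall>\<^sub>F n in sequentially. thr n (m n) (d n) < ereal (ln e)"
        using thr unfolding tendsto_MInfty by simp
      with regime show "\<forall>\<^sub>F n in sequentially. dist (x n) 0 < e"
      proof eventually_elim
        case (elim n)
        then have "ln (x n) < ln e" "0 < x n"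
          using thr_eq_ln[of "d n" n "m n"] by (auto simp: x_def)
        then show ?case using e by (simp add: dist_real_def)
      qed
    qed
    define r where "r n = exp 2 * sqrt (x n)" for n
    have r: "r \<longlonglongrightarrow> 0"
      unfolding r_def using tendsto_mult[OF tendsto_const[of "exp 2"] tendsto_real_sqrt[OF x]] by simp
    have "\<forall>\<^sub>F n in sequentially. r n < 1" "\<forall>\<^sub>F n in sequentially. x n < 1"
      using order_tendstoD(2)[OF r, of 1] order_tendstoD(2)[OF x, of 1] by auto
    then have "\<forall>\<^sub>F n in sequentially. 1 - r n / (1 - r n) \<le> prob_connected n (m n) (d n)"
      using regime
    proof eventually_elim
      case (elim n)
      then show ?case
        by (intro prob_connected_ge[of _ _ _ "x n"]) (auto simp: x_def r_def)
    qed
    \<comment> \<open>The limit is left unsimplified so that it matches the shape produced by the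
      limit rules.\<close>
    moreover have "(\<lambda>n. 1 - r n / (1 - r n)) \<longlonglongrightarrow> 1 - 0 / (1 - 0)"
      by (intro tendsto_diff tendsto_divide tendsto_const r) auto
    then have "(\<lambda>n. 1 - r n / (1 - r n)) \<longlonglongrightarrow> 1" by simp
    ultimately show ?thesis
      by (rule tendsto_sandwich[OF _ always_eventually[OF allI[OF le1]] _ tendsto_const])
  qed
  ultimately show ?thesis by blast
qed

end
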